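(* For any Łukasiewicz near semiring $\mathbf A$, the ideal lattice $\mathrm{Id}(\mathbf A)$ is pseudocomplemented: for every ideal $J$ there is a greatest ideal $I$ with $J\cap I=\{0\}$.
   Context: An $\iota$-near semiring is an algebra $\langle A,+,\cdot,{}^{\alpha},0,1\rangle$ of type $\langle 2,2,1,0,0\rangle$ such that $\langle A,+\rangle$ is a join semilattice with least element $0$ and greatest element $1$ (order $x\le y$ iff $x+y=y$), $x\cdot1=x=1\cdot x$, $(x+y)\cdot z=xz+yz$, $x0=0x=0$, $(x^{\alpha})^{\alpha}=x$, and $x\le y$ implies $y^{\alpha}\le x^{\alpha}$. A Łukasiewicz near semiring is an $\iota$-near semiring satisfying $(x y^{\alpha})^{\alpha} y^{\alpha}=(y x^{\alpha})^{\alpha} x^{\alpha}$. Juxtaposition $xy$ denotes $x\cdot y$. An ideal of $\mathbf A$ is a set $I\subseteq A$ with $0\in I$ such that (I1) if $ab^{\alpha}\in I$ and $b\in I$ then $a\in I$; (I2) if $a^{\alpha}b\in I$ and $b^{\alpha}a\in I$ then $(ac)^{\alpha}(bc)\in I$ and $(ca)^{\alpha}(cb)\in I$ for every $c\in A$. $\mathrm{Id}(\mathbf A)$ is the lattice of ideals ordered by inclusion. *)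

theory Defs
  imports "HOL-Algebra.Ring"
begin

text \<open>
  The signature is that of rings (sum, product, zero, one) extended by the unary
  operation \<open>\<alpha>\<close>. The product is not assumed to be associative or commutative,
  and only distributes over sums from the right.
\<close>

record 'a near_semiring = "'a ring" +
  alpha :: "'a \<Rightarrow> 'a" (\<open>_\<^sup>\<alpha>\<index>\<close> [100] 100)

definition near_le :: "('a, 'm) near_semiring_scheme \<Rightarrow> 'a \<Rightarrow> 'a \<Rightarrow> bool"
    (infix \<open>\<preceq>\<index>\<close> 50)
  where "x \<preceq>\<^bsub>A\<^esub> y \<longleftrightarrow> x \<oplus>\<^bsub>A\<^esub> y = y"

locale iota_near_semiring =
  fixes A :: "('a, 'm) near_semiring_scheme" (structure)
  assumes add_closed: "\<lbrakk>x \<in> carrier A; y \<in> carrier A\<rbrakk> \<Longrightarrow> x \<oplus> y \<in> carrier A"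
    and mult_closed: "\<lbrakk>x \<in> carrier A; y \<in> carrier A\<rbrakk> \<Longrightarrow> x \<otimes> y \<in> carrier A"
    and alpha_closed: "x \<in> carrier A \<Longrightarrow> x\<^sup>\<alpha> \<in> carrier A"
    and zero_closed: "\<zero> \<in> carrier A"
    and one_closed: "\<one> \<in> carrier A"
    and add_assoc: "\<lbrakk>x \<in> carrier A; y \<in> carrier A; z \<in> carrier A\<rbrakk>
          \<Longrightarrow> (x \<oplus> y) \<oplus> z = x \<oplus> (y \<oplus> z)"
    and add_comm: "\<lbrakk>x \<in> carrier A; y \<in> carrier A\<rbrakk> \<Longrightarrow> x \<oplus> y = y \<oplus> x"
    and add_idem: "x \<in> carrier A \<Longrightarrow> x \<oplus> x = x"
    and zero_least: "x \<in> carrier A \<Longrightarrow> \<zero> \<preceq> x"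
    and one_greatest: "x \<in> carrier A \<Longrightarrow> x \<preceq> \<one>"
    and mult_one_right: "x \<in> carrier A \<Longrightarrow> x \<otimes> \<one> = x"
    and mult_one_left: "x \<in> carrier A \<Longrightarrow> \<one> \<otimes> x = x"
    and distrib_right: "\<lbrakk>x \<in> carrier A; y \<in> carrier A; z \<in> carrier A\<rbrakk>
          \<Longrightarrow> (x \<oplus> y) \<otimes> z = (x \<otimes> z) \<oplus> (y \<otimes> z)"
    and mult_zero_right: "x \<in> carrier A \<Longrightarrow> x \<otimes> \<zero> = \<zero>"
    and mult_zero_left: "x \<in> carrier A \<Longrightarrow> \<zero> \<otimes> x = \<zero>"
    and alpha_alpha: "x \<in> carrier A \<Longrightarrow> (x\<^sup>\<alpha>)\<^sup>\<alpha> = x"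
    and alpha_antitone: "\<lbrakk>x \<in> carrier A; y \<in> carrier A; x \<preceq> y\<rbrakk> \<Longrightarrow> y\<^sup>\<alpha> \<preceq> x\<^sup>\<alpha>"

locale lukasiewicz_near_semiring = iota_near_semiring +
  assumes lukasiewicz: "\<lbrakk>x \<in> carrier A; y \<in> carrier A\<rbrakk>
    \<Longrightarrow> (x \<otimes> y\<^sup>\<alpha>)\<^sup>\<alpha> \<otimes> y\<^sup>\<alpha> = (y \<otimes> x\<^sup>\<alpha>)\<^sup>\<alpha> \<otimes> x\<^sup>\<alpha>"

definition near_ideal :: "('a, 'm) near_semiring_scheme \<Rightarrow> 'a set \<Rightarrow> bool"
  where "near_ideal A I \<longleftrightarrow>
    I \<subseteq> carrier A \<and> \<zero>\<^bsub>A\<^esub> \<in> I \<and>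
    (\<forall>a\<in>carrier A. \<forall>b\<in>carrier A. a \<otimes>\<^bsub>A\<^esub> b\<^sup>\<alpha>\<^bsub>A\<^esub> \<in> I \<longrightarrow> b \<in> I \<longrightarrow> a \<in> I) \<and>
    (\<forall>a\<in>carrier A. \<forall>b\<in>carrier A.
       a\<^sup>\<alpha>\<^bsub>A\<^esub> \<otimes>\<^bsub>A\<^esub> b \<in> I \<longrightarrow> b\<^sup>\<alpha>\<^bsub>A\<^esub> \<otimes>\<^bsub>A\<^esub> a \<in> I \<longrightarrow>
       (\<forall>c\<in>carrier A.
          (a \<otimes>\<^bsub>A\<^esub> c)\<^sup>\<alpha>\<^bsub>A\<^esub> \<otimes>\<^bsub>A\<^esub> (b \<otimes>\<^bsub>A\<^esub> c) \<in> I \<and>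
          (c \<otimes>\<^bsub>A\<^esub> a)\<^sup>\<alpha>\<^bsub>A\<^esub> \<otimes>\<^bsub>A\<^esub> (c \<otimes>\<^bsub>A\<^esub> b) \<in> I))"

definition ideal_lattice :: "('a, 'm) near_semiring_scheme \<Rightarrow> 'a set gorder"
  where "ideal_lattice A = \<lparr>carrier = {I. near_ideal A I}, eq = (=), le = (\<subseteq>)\<rparr>"

definition pseudocomplemented :: "('a, 'm) gorder_scheme \<Rightarrow> bool"
  where "pseudocomplemented L \<longleftrightarrow>
    lattice L \<and> weak_partial_order_bottom L \<and>
    (\<forall>x\<in>carrier L. \<exists>y. greatest L y {z \<in> carrier L. x \<sqinter>\<^bsub>L\<^esub> z = \<bottom>\<^bsub>L\<^esub>})"

end

theory Submission
  imports Defs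
begin

text \<open>
  Ideals are exactly the \<open>\<zero>\<close>-classes of congruences: an ideal \<open>I\<close> yields the congruence
  \<open>a \<sim> b \<longleftrightarrow> a\<^sup>\<alpha>b \<in> I \<and> b\<^sup>\<alpha>a \<in> I\<close>. Given an ideal \<open>J\<close>, take the transitive closure of the
  union of the congruences of all ideals \<open>K\<close> with \<open>J \<inter> K = {\<zero>}\<close>; its \<open>\<zero>\<close>-class is the
  pseudocomplement. Indeed, if \<open>x \<in> J\<close> is joined to \<open>\<zero>\<close> by a chain, take the meet of every
  member of the chain with \<open>x\<close>: the new chain lies in \<open>J\<close>, so consecutive members are congruent
  both modulo \<open>J\<close> and modulo some \<open>K\<close>, hence equal, and \<open>x = \<zero>\<close>.
\<close>

section \<open>Congruences and the relation attached to an ideal\<close>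

text \<open>In a Lukasiewicz near semiring the sum is the De Morgan dual of
  \<open>near_meet\<close>, hence a term in the product and \<alpha>, so respecting these two
  operations yields congruences of the full algebra.\<close>

definition near_congruence :: "('a, 'm) near_semiring_scheme \<Rightarrow> ('a \<times> 'a) set \<Rightarrow> bool"
  where "near_congruence A R \<longleftrightarrow> equiv (carrier A) R \<and>
    (\<forall>a b c d. (a, b) \<in> R \<longrightarrow> (c, d) \<in> R \<longrightarrow> (a \<otimes>\<^bsub>A\<^esub> c, b \<otimes>\<^bsub>A\<^esub> d) \<in> R) \<and>
    (\<forall>a b. (a, b) \<in> R \<longrightarrow> (a\<^sup>\<alpha>\<^bsub>A\<^esub>, b\<^sup>\<alpha>\<^bsub>A\<^esub>) \<in> R)"

definition ideal_cong :: "('a, 'm) near_semiring_scheme \<Rightarrow> 'a set \<Rightarrow> ('a \<times> 'a) set"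
  where "ideal_cong A I = {(a, b) \<in> carrier A \<times> carrier A.
    a\<^sup>\<alpha>\<^bsub>A\<^esub> \<otimes>\<^bsub>A\<^esub> b \<in> I \<and> b\<^sup>\<alpha>\<^bsub>A\<^esub> \<otimes>\<^bsub>A\<^esub> a \<in> I}"

lemma near_idealD:
  assumes "near_ideal A I"
  shows near_ideal_subset: "I \<subseteq> carrier A"
    and near_ideal_zero: "\<zero>\<^bsub>A\<^esub> \<in> I"
    and near_ideal_cancel: "\<And>a b. \<lbrakk>a \<in> carrier A; b \<in> I; a \<otimes>\<^bsub>A\<^esub> b\<^sup>\<alpha>\<^bsub>A\<^esub> \<in> I\<rbrakk> \<Longrightarrow> a \<in> I"
    and ideal_cong_mult_right:
      "\<And>a b c. \<lbrakk>(a, b) \<in> ideal_cong A I; c \<in> carrier A\<rbrakk>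
        \<Longrightarrow> (a \<otimes>\<^bsub>A\<^esub> c)\<^sup>\<alpha>\<^bsub>A\<^esub> \<otimes>\<^bsub>A\<^esub> (b \<otimes>\<^bsub>A\<^esub> c) \<in> I"
    and ideal_cong_mult_left:
      "\<And>a b c. \<lbrakk>(a, b) \<in> ideal_cong A I; c \<in> carrier A\<rbrakk>
        \<Longrightarrow> (c \<otimes>\<^bsub>A\<^esub> a)\<^sup>\<alpha>\<^bsub>A\<^esub> \<otimes>\<^bsub>A\<^esub> (c \<otimes>\<^bsub>A\<^esub> b) \<in> I"
  using assms unfolding near_ideal_def ideal_cong_def by blast+

lemma ideal_cong_carrier:
  "(a, b) \<in> ideal_cong A I \<Longrightarrow> a \<in> carrier A" "(a, b) \<in> ideal_cong A I \<Longrightarrow> b \<in> carrier A"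
  by (auto simp: ideal_cong_def)

lemma ideal_cong_sym: "(a, b) \<in> ideal_cong A I \<Longrightarrow> (b, a) \<in> ideal_cong A I"
  by (auto simp: ideal_cong_def)

lemma ideal_cong_Int: "ideal_cong A (I \<inter> J) = ideal_cong A I \<inter> ideal_cong A J"
  by (auto simp: ideal_cong_def)

context lukasiewicz_near_semiring
begin

section \<open>Order, annihilation and meets\<close>

lemma le_antisym: "\<lbrakk>x \<in> carrier A; y \<in> carrier A; x \<preceq> y; y \<preceq> x\<rbrakk> \<Longrightarrow> x = y"
  using add_comm by (simp add: near_le_def)

lemma alpha_zero: "\<zero>\<^sup>\<alpha> = \<one>"
proof (rule le_antisym)
  have "\<zero> \<preceq> \<one>\<^sup>\<alpha>"
    by (simp add: zero_least alpha_closed one_closed)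
  from alpha_antitone[OF _ _ this] show "\<one> \<preceq> \<zero>\<^sup>\<alpha>"
    by (simp add: zero_closed alpha_closed one_closed alpha_alpha)
qed (simp_all add: one_greatest zero_closed alpha_closed one_closed)

lemma alpha_one: "\<one>\<^sup>\<alpha> = \<zero>"
  using alpha_alpha[OF zero_closed] by (simp add: alpha_zero)

lemma mult_mono_left:
  "\<lbrakk>x \<in> carrier A; y \<in> carrier A; z \<in> carrier A; x \<preceq> y\<rbrakk> \<Longrightarrow> x \<otimes> z \<preceq> y \<otimes> z"
  using distrib_right[of x y z] by (simp add: near_le_def)

text \<open>Right distributivity makes the product monotone in its left factor; apply this to
  \<open>x \<preceq> \<one>\<close>.\<close>

lemma mult_le_right: "\<lbrakk>x \<in> carrier A; y \<in> carrier A\<rbrakk> \<Longrightarrow> x \<otimes> y \<preceq> y"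
  using mult_mono_left[of x \<one> y] by (simp add: one_closed one_greatest mult_one_left)

text \<open>In the Lukasiewicz identity at \<open>y = \<one>\<close>, the left side ends in the
  factor \<open>\<one>\<^sup>\<alpha> = \<zero>\<close> and the right side reduces to
  \<open>x \<otimes> x\<^sup>\<alpha>\<close>.\<close>

lemma mult_alpha_self: "x \<in> carrier A \<Longrightarrow> x \<otimes> x\<^sup>\<alpha> = \<zero>"
  using lukasiewicz[of x \<one>]
  by (simp add: one_closed alpha_one alpha_zero alpha_closed alpha_alpha zero_closed mult_zero_right mult_one_left)

lemma alpha_mult_self: "x \<in> carrier A \<Longrightarrow> x\<^sup>\<alpha> \<otimes> x = \<zero>"
  using mult_alpha_self[of "x\<^sup>\<alpha>"] by (simp add: alpha_closed alpha_alpha)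

text \<open>Multiplying by \<open>y\<^sup>\<alpha>\<close> on the right gives a product below
  \<open>y \<otimes> y\<^sup>\<alpha> = \<zero>\<close>. This turns the order into the products that
  (I1) speaks of.\<close>

lemma mult_alpha_eq_zero:
  assumes "x \<in> carrier A" "y \<in> carrier A" "x \<preceq> y"
  shows "x \<otimes> y\<^sup>\<alpha> = \<zero>"
proof (rule le_antisym)
  show "x \<otimes> y\<^sup>\<alpha> \<preceq> \<zero>"
    using mult_mono_left[of x y "y\<^sup>\<alpha>"] assms by (simp add: alpha_closed mult_alpha_self)
qed (use assms in \<open>simp_all add: mult_closed alpha_closed zero_closed zero_least\<close>)

text \<open>The lattice meet, written in the multiplicative signature.\<close>

definition near_meet :: "'a \<Rightarrow> 'a \<Rightarrow> 'a"
  where "near_meet x y = (x\<^sup>\<alpha> \<otimes> y)\<^sup>\<alpha> \<otimes> y"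

lemma near_meet_closed: "\<lbrakk>x \<in> carrier A; y \<in> carrier A\<rbrakk> \<Longrightarrow> near_meet x y \<in> carrier A"
  by (simp add: near_meet_def mult_closed alpha_closed)

text \<open>This is the Lukasiewicz identity at \<open>x\<^sup>\<alpha>\<close> and
  \<open>y\<^sup>\<alpha>\<close>.\<close>

lemma near_meet_commute:
  "\<lbrakk>x \<in> carrier A; y \<in> carrier A\<rbrakk> \<Longrightarrow> near_meet x y = near_meet y x"
  using lukasiewicz[of "x\<^sup>\<alpha>" "y\<^sup>\<alpha>"] by (simp add: near_meet_def alpha_closed alpha_alpha)

lemma near_meet_le: "\<lbrakk>x \<in> carrier A; y \<in> carrier A\<rbrakk> \<Longrightarrow> near_meet x y \<preceq> y"
  by (simp add: near_meet_def mult_le_right mult_closed alpha_closed)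

lemma near_meet_zero: "x \<in> carrier A \<Longrightarrow> near_meet \<zero> x = \<zero>"
  by (simp add: near_meet_def alpha_zero mult_one_left alpha_mult_self)

lemma near_meet_self: "x \<in> carrier A \<Longrightarrow> near_meet x x = x"
  by (simp add: near_meet_def alpha_mult_self alpha_zero mult_one_left)

lemma near_congruence_near_meet:
  assumes "near_congruence A R" "(a, b) \<in> R" "(c, d) \<in> R"
  shows "(near_meet a c, near_meet b d) \<in> R"
  using assms unfolding near_congruence_def near_meet_def by blast

section \<open>Zero-classes of congruences are ideals\<close>

lemma near_ideal_zero_class:
  assumes R: "near_congruence A R"
  shows "near_ideal A {a \<in> carrier A. (a, \<zero>) \<in> R}"
proof -
  have eqv: "equiv (carrier A) R"
    and cm: "\<And>a b c d. (a, b) \<in> R \<Longrightarrow> (c, d) \<in> R \<Longrightarrow> (a \<otimes> c, b \<otimes> d) \<in> R"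
    and ca: "\<And>a b. (a, b) \<in> R \<Longrightarrow> (a\<^sup>\<alpha>, b\<^sup>\<alpha>) \<in> R"
    using R unfolding near_congruence_def by blast+
  have refl: "\<And>a. a \<in> carrier A \<Longrightarrow> (a, a) \<in> R"
    using eqv by (meson equiv_def refl_onD)
  have sym: "\<And>a b. (a, b) \<in> R \<Longrightarrow> (b, a) \<in> R"
    using eqv by (meson equiv_def symD)
  have trans: "\<And>a b c. (a, b) \<in> R \<Longrightarrow> (b, c) \<in> R \<Longrightarrow> (a, c) \<in> R"
    using eqv by (meson equiv_def transD)
  have I1: "(a, \<zero>) \<in> R"
    if "a \<in> carrier A" "(a \<otimes> b\<^sup>\<alpha>, \<zero>) \<in> R" "(b, \<zero>) \<in> R" for a b
  proof -
    \<comment> \<open>From \<open>b\<close> ~ \<zero> follows \<open>b\<^sup>\<alpha>\<close> ~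
      \<one>, and \<one> is a right unit.\<close>
    have "(a \<otimes> b\<^sup>\<alpha>, a) \<in> R"
      using cm[OF refl ca, OF that(1,3)] that(1) by (simp add: alpha_zero mult_one_right)
    with that(2) show ?thesis
      using sym trans by blast
  qed
  have meet: "(near_meet a b, b) \<in> R" if "b \<in> carrier A" "(a\<^sup>\<alpha> \<otimes> b, \<zero>) \<in> R" for a b
    using cm[OF ca refl, OF that(2,1)] that(1)
    by (simp add: near_meet_def alpha_zero mult_one_left)
  \<comment> \<open>The two meets of \<open>a\<close> and \<open>b\<close> are related to
    \<open>b\<close> and to \<open>a\<close> respectively, and they are equal by commutativity. This
    reduces (I2) to compatibility of \<open>R\<close> with the product.\<close>
  have ab: "(a, b) \<in> R"
    if "a \<in> carrier A" "b \<in> carrier A" "(a\<^sup>\<alpha> \<otimes> b, \<zero>) \<in> R" "(b\<^sup>\<alpha> \<otimes> a, \<zero>) \<in> R" for a b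
    using meet[OF that(2,3)] meet[OF that(1,4)] near_meet_commute[OF that(1,2)] sym trans
    by metis
  have diff: "(a\<^sup>\<alpha> \<otimes> b, \<zero>) \<in> R" if "(a, b) \<in> R" "b \<in> carrier A" for a b
    using cm[OF ca refl, OF that] that(2) by (simp add: alpha_mult_self)
  show ?thesis
    unfolding near_ideal_def mem_Collect_eq
  proof (intro conjI ballI impI)
    fix a b c
    assume *: "a \<in> carrier A" "b \<in> carrier A" "c \<in> carrier A"
      and "a\<^sup>\<alpha> \<otimes> b \<in> carrier A \<and> (a\<^sup>\<alpha> \<otimes> b, \<zero>) \<in> R" "b\<^sup>\<alpha> \<otimes> a \<in> carrier A \<and> (b\<^sup>\<alpha> \<otimes> a, \<zero>) \<in> R"
    then have "(a, b) \<in> R"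
      using ab by blast
    with * show "((a \<otimes> c)\<^sup>\<alpha> \<otimes> (b \<otimes> c), \<zero>) \<in> R" "((c \<otimes> a)\<^sup>\<alpha> \<otimes> (c \<otimes> b), \<zero>) \<in> R"
      using diff[OF cm[OF _ refl]] diff[OF cm[OF refl]] by (blast intro: mult_closed)+
  qed (use I1 in \<open>auto simp: zero_closed refl mult_closed alpha_closed\<close>)
qed

lemma near_ideal_carrier: "near_ideal A (carrier A)"
  by (simp add: near_ideal_def zero_closed mult_closed alpha_closed)

text \<open>It is the zero-class of the equality congruence.\<close>

lemma near_ideal_singleton_zero: "near_ideal A {\<zero>}"
proof -
  have "near_congruence A (Id_on (carrier A))"
    unfolding near_congruence_def
    by (auto simp: mult_closed alpha_closed intro!: equivI refl_onI symI transI)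
  moreover have "{a \<in> carrier A. (a, \<zero>) \<in> Id_on (carrier A)} = {\<zero>}"
    using zero_closed by auto
  ultimately show ?thesis
    using near_ideal_zero_class by metis
qed

section \<open>Intersections and downward closure\<close>

text \<open>The family is nonempty because the empty intersection is the whole type, not
  \<open>carrier A\<close>.\<close>

lemma near_ideal_Inter:
  assumes "\<I> \<noteq> {}" "\<And>I. I \<in> \<I> \<Longrightarrow> near_ideal A I"
  shows "near_ideal A (\<Inter>\<I>)"
  unfolding near_ideal_def
proof (intro conjI ballI impI)
  show "\<Inter>\<I> \<subseteq> carrier A"
    using assms near_ideal_subset by blast
  show "\<zero> \<in> \<Inter>\<I>"
    using assms near_ideal_zero by blast
next
  fix a b assume "a \<in> carrier A" "a \<otimes> b\<^sup>\<alpha> \<in> \<Inter>\<I>" "b \<in> \<Inter>\<I>"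
  then show "a \<in> \<Inter>\<I>"
    using near_ideal_cancel[OF assms(2)] by (metis InterD InterI)
next
  fix a b c
  assume *: "a \<in> carrier A" "b \<in> carrier A" "a\<^sup>\<alpha> \<otimes> b \<in> \<Inter>\<I>" "b\<^sup>\<alpha> \<otimes> a \<in> \<Inter>\<I>" "c \<in> carrier A"
  have "(a, b) \<in> ideal_cong A I" if "I \<in> \<I>" for I
    using that * by (auto simp: ideal_cong_def)
  then show "(a \<otimes> c)\<^sup>\<alpha> \<otimes> (b \<otimes> c) \<in> \<Inter>\<I>" "(c \<otimes> a)\<^sup>\<alpha> \<otimes> (c \<otimes> b) \<in> \<Inter>\<I>"
    using ideal_cong_mult_right[OF assms(2)] ideal_cong_mult_left[OF assms(2)] *(5)
    by (meson InterI)+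
qed

lemma near_ideal_Int: "\<lbrakk>near_ideal A I; near_ideal A J\<rbrakk> \<Longrightarrow> near_ideal A (I \<inter> J)"
  using near_ideal_Inter[of "{I, J}"] by auto

text \<open>Since \<open>x \<otimes> y\<^sup>\<alpha>\<close> is \<zero>, it lies in
  \<open>I\<close>, and (I1) applies.\<close>

lemma near_ideal_downward:
  assumes "near_ideal A I" "x \<in> carrier A" "y \<in> I" "x \<preceq> y"
  shows "x \<in> I"
proof (rule near_ideal_cancel[OF assms(1-3)])
  have "y \<in> carrier A"
    using assms near_ideal_subset by blast
  then show "x \<otimes> y\<^sup>\<alpha> \<in> I"
    using assms by (simp add: mult_alpha_eq_zero near_ideal_zero)
qed

section \<open>The congruence of an ideal\<close>

text \<open>By (I2), multiply \<open>b\<close> ~ \<open>a\<close> on the right by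
  \<open>b\<^sup>\<alpha>\<close>; the factor
  \<open>(b \<otimes> b\<^sup>\<alpha>)\<^sup>\<alpha>\<close> is \<one>. The resulting product has
  the shape required by (I1).\<close>

lemma ideal_cong_mult_alpha:
  assumes I: "near_ideal A I" and ab: "(a, b) \<in> ideal_cong A I"
  shows "a \<otimes> b\<^sup>\<alpha> \<in> I"
proof -
  have b: "b \<in> carrier A" and a: "a \<in> carrier A"
    using ab by (auto simp: ideal_cong_def)
  have "(b \<otimes> b\<^sup>\<alpha>)\<^sup>\<alpha> \<otimes> (a \<otimes> b\<^sup>\<alpha>) \<in> I"
    using ideal_cong_mult_right[OF I ideal_cong_sym[OF ab]] b by (simp add: alpha_closed)
  then show ?thesis
    using a b by (simp add: mult_alpha_self alpha_zero mult_one_left mult_closed alpha_closed)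
qed

lemma near_congruence_ideal_cong:
  assumes I: "near_ideal A I"
  shows "near_congruence A (ideal_cong A I)"
proof -
  let ?R = "ideal_cong A I"
  have right: "(a \<otimes> c, b \<otimes> c) \<in> ?R" and left: "(c \<otimes> a, c \<otimes> b) \<in> ?R"
    if "(a, b) \<in> ?R" "c \<in> carrier A" for a b c
    using ideal_cong_mult_right[OF I] ideal_cong_mult_left[OF I] ideal_cong_sym[OF that(1)]
      that ideal_cong_carrier[OF that(1)]
    by (auto simp: ideal_cong_def mult_closed)
  have alpha: "(a\<^sup>\<alpha>, b\<^sup>\<alpha>) \<in> ?R" if "(a, b) \<in> ?R" for a b
    using ideal_cong_mult_alpha[OF I that] ideal_cong_mult_alpha[OF I ideal_cong_sym[OF that]]
      ideal_cong_carrier[OF that]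
    by (auto simp: ideal_cong_def alpha_closed alpha_alpha)
  \<comment> \<open>Left multiplication of \<open>c\<close> ~ \<open>b\<close> by
    \<open>a\<^sup>\<alpha>\<close> relates \<open>a\<^sup>\<alpha> \<otimes> c\<close> to
    \<open>a\<^sup>\<alpha> \<otimes> b\<close>, which lies in \<open>I\<close>; (I1) carries
    membership over. Both halves of transitivity are instances.\<close>
  have half: "a\<^sup>\<alpha> \<otimes> c \<in> I" if ab: "(a, b) \<in> ?R" and bc: "(b, c) \<in> ?R" for a b c
  proof -
    have "a \<in> carrier A" "c \<in> carrier A"
      using ideal_cong_carrier[OF ab] ideal_cong_carrier[OF bc] by auto
    moreover have "(a\<^sup>\<alpha> \<otimes> c, a\<^sup>\<alpha> \<otimes> b) \<in> ?R"
      using left[OF ideal_cong_sym[OF bc]] calculation by (simp add: alpha_closed)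
    moreover have "a\<^sup>\<alpha> \<otimes> b \<in> I"
      using ab by (simp add: ideal_cong_def)
    ultimately show ?thesis
      using near_ideal_cancel[OF I _ _ ideal_cong_mult_alpha[OF I]] mult_closed alpha_closed
      by blast
  qed
  have trans: "(a, c) \<in> ?R" if ab: "(a, b) \<in> ?R" and bc: "(b, c) \<in> ?R" for a b c
    using half[OF ab bc] half[OF ideal_cong_sym[OF bc] ideal_cong_sym[OF ab]]
      ideal_cong_carrier[OF ab] ideal_cong_carrier[OF bc]
    by (simp add: ideal_cong_def)
  have "equiv (carrier A) ?R"
  proof (rule equivI)
    show "?R \<subseteq> carrier A \<times> carrier A"
      by (auto simp: ideal_cong_def)
    show "refl_on (carrier A) ?R"
      by (auto simp: ideal_cong_def refl_on_def alpha_mult_self near_ideal_zero[OF I])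
    show "sym ?R" "trans ?R"
      using ideal_cong_sym trans by (metis symI, metis transI)
  qed
  moreover have "(a \<otimes> c, b \<otimes> d) \<in> ?R" if "(a, b) \<in> ?R" "(c, d) \<in> ?R" for a b c d
    using trans[OF right left] that ideal_cong_carrier by metis
  ultimately show ?thesis
    unfolding near_congruence_def using alpha by blast
qed

text \<open>When \<open>a\<^sup>\<alpha> \<otimes> b\<close> vanishes, the meet of \<open>a\<close>
  and \<open>b\<close> is \<open>b\<close>; symmetrically it is \<open>a\<close>.\<close>

lemma ideal_cong_singleton_zero: "(a, b) \<in> ideal_cong A {\<zero>} \<Longrightarrow> a = b"
proof -
  assume "(a, b) \<in> ideal_cong A {\<zero>}"
  then have *: "a \<in> carrier A" "b \<in> carrier A" "a\<^sup>\<alpha> \<otimes> b = \<zero>" "b\<^sup>\<alpha> \<otimes> a = \<zero>"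
    by (auto simp: ideal_cong_def)
  then show "a = b"
    using near_meet_commute[OF *(1,2)] by (simp add: near_meet_def alpha_zero mult_one_left)
qed

text \<open>The products to test are \<open>x\<^sup>\<alpha> \<otimes> \<zero> = \<zero>\<close> and
  \<open>\<zero>\<^sup>\<alpha> \<otimes> x = x\<close>, so an ideal is recovered as the zero-class
  of its congruence.\<close>

lemma ideal_cong_zero_iff:
  "x \<in> carrier A \<Longrightarrow> near_ideal A I \<Longrightarrow> (x, \<zero>) \<in> ideal_cong A I \<longleftrightarrow> x \<in> I"
  by (auto simp: ideal_cong_def zero_closed alpha_zero mult_zero_right mult_one_left
      near_ideal_zero alpha_closed)

text \<open>A product lies below its right factor, so both test products lie in \<open>I\<close> by
  downward closure.\<close>

lemma ideal_cong_members:
  assumes I: "near_ideal A I" and "a \<in> I" "b \<in> I"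
  shows "(a, b) \<in> ideal_cong A I"
proof -
  have c: "a \<in> carrier A" "b \<in> carrier A"
    using assms near_ideal_subset by blast+
  then have "a\<^sup>\<alpha> \<otimes> b \<preceq> b" "b\<^sup>\<alpha> \<otimes> a \<preceq> a"
    by (simp_all add: mult_le_right alpha_closed)
  then show ?thesis
    using near_ideal_downward[OF I _ \<open>a \<in> I\<close>] near_ideal_downward[OF I _ \<open>b \<in> I\<close>] c
    by (auto simp: ideal_cong_def mult_closed alpha_closed)
qed

section \<open>Joins of congruences\<close>

text \<open>Operations are applied link by link along a chain. A nonempty family supplies
  reflexivity on the carrier.\<close>

lemma near_congruence_trancl_Union:
  assumes ne: "\<R> \<noteq> {}" and cong: "\<And>R. R \<in> \<R> \<Longrightarrow> near_congruence A R"
  shows "near_congruence A ((\<Union>\<R>)\<^sup>+)"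
proof -
  let ?U = "\<Union>\<R>"
  have sub: "?U \<subseteq> carrier A \<times> carrier A" and refl: "refl_on (carrier A) ?U" and sym: "sym ?U"
    using ne cong unfolding near_congruence_def equiv_def refl_on_def sym_def by blast+
  have carr: "a \<in> carrier A \<and> b \<in> carrier A" if "(a, b) \<in> ?U\<^sup>+" for a b
    using trancl_subset_Sigma[OF sub] that by auto
  have "equiv (carrier A) (?U\<^sup>+)"
  proof (rule equivI)
    show "?U\<^sup>+ \<subseteq> carrier A \<times> carrier A"
      by (rule trancl_subset_Sigma[OF sub])
    show "refl_on (carrier A) (?U\<^sup>+)"
      using refl unfolding refl_on_def by blast
  qed (simp_all add: sym_trancl sym)
  moreover have "(a\<^sup>\<alpha>, b\<^sup>\<alpha>) \<in> ?U\<^sup>+" if "(a, b) \<in> ?U\<^sup>+" for a b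
  proof -
    have "(a\<^sup>\<alpha>, b\<^sup>\<alpha>) \<in> ?U" if "(a, b) \<in> ?U" for a b
      using that cong unfolding near_congruence_def by blast
    note step = this
    show ?thesis
      using that by (induction rule: trancl_induct) (blast intro: trancl_into_trancl step)+
  qed
  moreover have "(a \<otimes> c, b \<otimes> d) \<in> ?U\<^sup>+" if ab: "(a, b) \<in> ?U\<^sup>+" and cd: "(c, d) \<in> ?U\<^sup>+" for a b c d
  proof -
    have step: "(u \<otimes> w, v \<otimes> w) \<in> ?U \<and> (w \<otimes> u, w \<otimes> v) \<in> ?U"
      if "(u, v) \<in> ?U" "w \<in> carrier A" for u v w
    proof -
      obtain R where "R \<in> \<R>" "(u, v) \<in> R"
        using \<open>(u, v) \<in> ?U\<close> by blast
      moreover have "near_congruence A R" "(w, w) \<in> R"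
        using cong[OF \<open>R \<in> \<R>\<close>] that(2) unfolding near_congruence_def equiv_def refl_on_def
        by blast+
      ultimately show ?thesis
        unfolding near_congruence_def by blast
    qed
    \<comment> \<open>The two chains may differ in length, so one factor moves at a time: first
      \<open>a\<close> to \<open>b\<close> with \<open>c\<close> fixed, then \<open>c\<close> to
      \<open>d\<close> with \<open>b\<close> fixed.\<close>
    have "(a \<otimes> c, b \<otimes> c) \<in> ?U\<^sup>+"
      using ab
      by (induction rule: trancl_induct)
        (use step carr[OF cd] in \<open>blast intro: trancl_into_trancl\<close>)+
    moreover have "(b \<otimes> c, b \<otimes> d) \<in> ?U\<^sup>+"
      using cd
      by (induction rule: trancl_induct)
        (use step carr[OF ab] in \<open>blast intro: trancl_into_trancl\<close>)+
    ultimately show ?thesis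
      by (rule trancl_trans)
  qed
  ultimately show ?thesis
    unfolding near_congruence_def by blast
qed

section \<open>The pseudocomplement\<close>

lemma ex_greatest_disjoint_ideal:
  assumes J: "near_ideal A J"
  shows "\<exists>I. near_ideal A I \<and> J \<inter> I = {\<zero>} \<and>
    (\<forall>K. near_ideal A K \<longrightarrow> J \<inter> K = {\<zero>} \<longrightarrow> K \<subseteq> I)"
proof -
  define \<R> where "\<R> = ideal_cong A ` {K. near_ideal A K \<and> J \<inter> K = {\<zero>}}"
  have "\<R> \<noteq> {}"
    using near_ideal_singleton_zero near_ideal_zero[OF J] by (auto simp: \<R>_def)
  moreover have cong: "near_congruence A R" if "R \<in> \<R>" for R
    using that near_congruence_ideal_cong by (auto simp: \<R>_def)
  ultimately have C: "near_congruence A ((\<Union>\<R>)\<^sup>+)"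
    by (rule near_congruence_trancl_Union)
  define I where "I = {a \<in> carrier A. (a, \<zero>) \<in> (\<Union>\<R>)\<^sup>+}"
  have I: "near_ideal A I"
    unfolding I_def by (rule near_ideal_zero_class[OF C])
  have "x = \<zero>" if "x \<in> J" "x \<in> I" for x
  proof -
    have x: "x \<in> carrier A"
      using that near_ideal_subset[OF I] by blast
    have step: "near_meet a x = near_meet b x" if ab: "(a, b) \<in> \<Union>\<R>" for a b
    proof -
      obtain K where K: "near_ideal A K" "J \<inter> K = {\<zero>}" "(a, b) \<in> ideal_cong A K"
        using ab by (auto simp: \<R>_def)
      note car = ideal_cong_carrier[OF K(3)]
      have "(x, x) \<in> ideal_cong A K"
        using x near_ideal_zero[OF K(1)] by (simp add: ideal_cong_def alpha_mult_self)
      then have "(near_meet a x, near_meet b x) \<in> ideal_cong A K"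
        using near_congruence_near_meet[OF near_congruence_ideal_cong] K by blast
      moreover have "near_meet a x \<in> J" "near_meet b x \<in> J"
        \<comment> \<open>Both meets lie below \<open>x\<close>, which belongs to
          \<open>J\<close>.\<close>
        using near_ideal_downward[OF J near_meet_closed \<open>x \<in> J\<close> near_meet_le] car x by auto
      then have "(near_meet a x, near_meet b x) \<in> ideal_cong A J"
        by (rule ideal_cong_members[OF J])
      ultimately have "(near_meet a x, near_meet b x) \<in> ideal_cong A (J \<inter> K)"
        by (simp add: ideal_cong_Int)
      then show ?thesis
        unfolding K(2) by (rule ideal_cong_singleton_zero)
    qed
    have "(x, \<zero>) \<in> (\<Union>\<R>)\<^sup>+"
      using \<open>x \<in> I\<close> by (simp add: I_def)
    \<comment> \<open>Every link preserves the meet with \<open>x\<close>, so the ends of the chain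
      from \<open>x\<close> to \<zero> have equal meets with it, namely \<open>x\<close> and
      \<zero>.\<close>
    then have "near_meet x x = near_meet \<zero> x"
      by (induction rule: trancl_induct) (simp_all only: step)
    then show ?thesis
      by (simp add: x near_meet_self near_meet_zero)
  qed
  then have "J \<inter> I = {\<zero>}"
    using near_ideal_zero[OF J] near_ideal_zero[OF I] by blast
  moreover have "K \<subseteq> I" if K: "near_ideal A K" "J \<inter> K = {\<zero>}" for K
  proof
    fix a assume "a \<in> K"
    moreover have "a \<in> carrier A"
      using \<open>a \<in> K\<close> near_ideal_subset[OF K(1)] by blast
    \<comment> \<open>The congruence of \<open>K\<close> itself provides a chain with a single
      link.\<close>
    ultimately have "(a, \<zero>) \<in> \<Union>\<R>"
      using K by (auto simp: \<R>_def ideal_cong_zero_iff)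
    then show "a \<in> I"
      using \<open>a \<in> carrier A\<close> by (auto simp: I_def)
  qed
  ultimately show ?thesis
    using I by blast
qed

section \<open>The lattice of ideals\<close>

lemma carrier_ideal_lattice: "I \<in> carrier (ideal_lattice A) \<longleftrightarrow> near_ideal A I"
  by (simp add: ideal_lattice_def)

lemma partial_order_ideal_lattice: "partial_order (ideal_lattice A)"
  by unfold_locales (auto simp: ideal_lattice_def)

lemma lattice_ideal_lattice: "lattice (ideal_lattice A)"
proof -
  interpret partial_order "ideal_lattice A"
    by (rule partial_order_ideal_lattice)
  show ?thesis
  proof unfold_locales
    fix I J assume IJ: "I \<in> carrier (ideal_lattice A)" "J \<in> carrier (ideal_lattice A)"
    \<comment> \<open>The join is the ideal generated by the union; \<open>carrier A\<close> shows
      that the intersected family is nonempty.\<close>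
    define S where "S = \<Inter>{K. near_ideal A K \<and> I \<union> J \<subseteq> K}"
    have "near_ideal A S"
      unfolding S_def
      using IJ near_ideal_carrier near_ideal_subset
      by (intro near_ideal_Inter) (auto simp: ideal_lattice_def)
    then have "least (ideal_lattice A) S (Upper (ideal_lattice A) {I, J})"
      using IJ by (auto simp: least_def Upper_def ideal_lattice_def S_def)
    then show "\<exists>s. least (ideal_lattice A) s (Upper (ideal_lattice A) {I, J})"
      by blast
    have "greatest (ideal_lattice A) (I \<inter> J) (Lower (ideal_lattice A) {I, J})"
      using IJ near_ideal_Int by (auto simp: greatest_def Lower_def ideal_lattice_def)
    then show "\<exists>s. greatest (ideal_lattice A) s (Lower (ideal_lattice A) {I, J})"
      by blast
  qed
qed

text \<open>The abstract meet is a chosen greatest lower bound, so uniqueness of greatest elements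
  identifies it with the intersection.\<close>

lemma meet_ideal_lattice:
  assumes "near_ideal A I" "near_ideal A J"
  shows "I \<sqinter>\<^bsub>ideal_lattice A\<^esub> J = I \<inter> J"
proof -
  interpret L: lattice "ideal_lattice A"
    by (rule lattice_ideal_lattice)
  have "greatest (ideal_lattice A) (I \<inter> J) (Lower (ideal_lattice A) {I, J})"
    using assms near_ideal_Int by (auto simp: greatest_def Lower_def ideal_lattice_def)
  moreover have "greatest (ideal_lattice A) (I \<sqinter>\<^bsub>ideal_lattice A\<^esub> J)
      (Lower (ideal_lattice A) {I, J})"
    using assms
    by (intro L.inf_of_two_greatest[folded meet_def]) (auto simp: ideal_lattice_def)
  ultimately show ?thesis
    by (metis L.greatest_unique)
qed

lemma least_ideal_lattice:
  "least (ideal_lattice A) {\<zero>} (carrier (ideal_lattice A))"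
  using near_ideal_singleton_zero near_ideal_zero by (auto simp: least_def ideal_lattice_def)

lemma bottom_ideal_lattice: "\<bottom>\<^bsub>ideal_lattice A\<^esub> = {\<zero>}"
proof -
  interpret partial_order "ideal_lattice A"
    by (rule partial_order_ideal_lattice)
  show ?thesis
    unfolding bottom_def
    by (rule some_equality) (simp_all add: least_ideal_lattice least_unique[OF _ least_ideal_lattice])
qed

lemma weak_partial_order_bottom_ideal_lattice:
  "weak_partial_order_bottom (ideal_lattice A)"
proof -
  interpret partial_order "ideal_lattice A"
    by (rule partial_order_ideal_lattice)
  show ?thesis
    by unfold_locales (use least_ideal_lattice in blast)
qed

end

theorem theorem4:
  fixes A :: "('a, 'm) near_semiring_scheme"
  assumes "lukasiewicz_near_semiring A"
  shows "pseudocomplemented (ideal_lattice A) \<and>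
    (\<forall>J. near_ideal A J \<longrightarrow>
      (\<exists>I. near_ideal A I \<and> J \<inter> I = {\<zero>\<^bsub>A\<^esub>} \<and>
        (\<forall>K. near_ideal A K \<longrightarrow> J \<inter> K = {\<zero>\<^bsub>A\<^esub>} \<longrightarrow> K \<subseteq> I)))"
proof -
  interpret lukasiewicz_near_semiring A
    by (rule assms)
  have "\<exists>I. greatest (ideal_lattice A) I
      {K \<in> carrier (ideal_lattice A). J \<sqinter>\<^bsub>ideal_lattice A\<^esub> K = \<bottom>\<^bsub>ideal_lattice A\<^esub>}"
    if "J \<in> carrier (ideal_lattice A)" for J
  proof -
    have J: "near_ideal A J"
      using that by (simp add: carrier_ideal_lattice)
    \<comment> \<open>Replacing the abstract meet and bottom by intersection and the zero ideal
      makes the set-level result applicable.\<close>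
    have set_eq: "{K \<in> carrier (ideal_lattice A). J \<sqinter>\<^bsub>ideal_lattice A\<^esub> K = \<bottom>\<^bsub>ideal_lattice A\<^esub>} =
        {K. near_ideal A K \<and> J \<inter> K = {\<zero>\<^bsub>A\<^esub>}}"
      unfolding carrier_ideal_lattice bottom_ideal_lattice
      by (rule Collect_cong) (metis meet_ideal_lattice[OF J])
    obtain I where "near_ideal A I" "J \<inter> I = {\<zero>\<^bsub>A\<^esub>}"
      and "\<And>K. \<lbrakk>near_ideal A K; J \<inter> K = {\<zero>\<^bsub>A\<^esub>}\<rbrakk> \<Longrightarrow> K \<subseteq> I"
      using ex_greatest_disjoint_ideal[OF J] by blast
    then have "greatest (ideal_lattice A) I {K. near_ideal A K \<and> J \<inter> K = {\<zero>\<^bsub>A\<^esub>}}"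
      by (simp add: greatest_def ideal_lattice_def Collect_mono)
    then show ?thesis
      unfolding set_eq by blast
  qed
  then show ?thesis
    unfolding pseudocomplemented_def
    using lattice_ideal_lattice weak_partial_order_bottom_ideal_lattice ex_greatest_disjoint_ideal
    by blast
qed

end
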